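(* Let $\mathfrak{L}$ be a left Leibniz algebra over a field $\mathbb{F}$. Then the following statements are equivalent: (i) $\mathfrak{L}$ is solvable. (ii) $\mathfrak{L}_{\mathrm{Lie}}$ is solvable. (iii) $\mathfrak{L}/C_\ell(\mathfrak{L})$ is solvable. (iv) $L(\mathfrak{L})$ is solvable.
   Context: An algebra over a field $\mathbb{F}$ is an $\mathbb{F}$-vector space (of arbitrary dimension) with a bilinear multiplication $(x,y)\mapsto xy$, not assumed associative. A left Leibniz algebra is an algebra $\mathfrak{L}$ with $x(yz)=(xy)z+y(xz)$ for all $x,y,z\in\mathfrak{L}$. For an algebra $\mathfrak{A}$, the derived series is $\mathfrak{A}^{(0)}:=\mathfrak{A}$, $\mathfrak{A}^{(n+1)}:=\mathfrak{A}^{(n)}\mathfrak{A}^{(n)}$, where a product of two subspaces denotes the linear span of all products of their elements; $\mathfrak{A}$ is solvable if $\mathfrak{A}^{(r)}=0$ for some non-negative integer $r$ (Lie algebras are regarded as algebras via their bracket). The Leibniz kernel $\mathrm{Leib}(\mathfrak{L})$ is the $\mathbb{F}$-span of $\{x^2=xx\mid x\in\mathfrak{L}\}$; it is a (two-sided) ideal, and $\mathfrak{L}_{\mathrm{Lie}}:=\mathfrak{L}/\mathrm{Leib}(\mathfrak{L})$ is the canonical Lie algebra associated to $\mathfrak{L}$. The left center is $C_\ell(\mathfrak{L}):=\{c\in\mathfrak{L}\mid cx=0\text{ for all }x\in\mathfrak{L}\}$, which is an ideal of $\mathfrak{L}$. For $a\in\mathfrak{L}$ let $L_a:\mathfrak{L}\to\mathfrak{L}$,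 $x\mapsto ax$; $L(\mathfrak{L}):=\{L_a\mid a\in\mathfrak{L}\}$, which is a Lie subalgebra of $\mathfrak{gl}(\mathfrak{L})$ (all linear operators on $\mathfrak{L}$ with the commutator bracket). *)

theory Defs
  imports HOL.Hull "HOL-Algebra.QuotRing" "HOL-Algebra.Module"
begin

text \<open>
  The record \<open>module\<close> of HOL-Algebra extends \<open>ring\<close>, so it already carries a multiplication.
  Its field \<open>one\<close> plays no role below, since algebras are neither unital nor associative here.
\<close>

locale nonassoc_algebra = F?: field F + A?: module F A
  for F (structure) and A (structure) +
  assumes mult_closed [simp, intro]:
      "\<lbrakk>x \<in> carrier A; y \<in> carrier A\<rbrakk> \<Longrightarrow> x \<otimes>\<^bsub>A\<^esub> y \<in> carrier A"
    and mult_l_distr: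
      "\<lbrakk>x \<in> carrier A; y \<in> carrier A; z \<in> carrier A\<rbrakk> \<Longrightarrow>
        (x \<oplus>\<^bsub>A\<^esub> y) \<otimes>\<^bsub>A\<^esub> z = x \<otimes>\<^bsub>A\<^esub> z \<oplus>\<^bsub>A\<^esub> y \<otimes>\<^bsub>A\<^esub> z"
    and mult_r_distr:
      "\<lbrakk>x \<in> carrier A; y \<in> carrier A; z \<in> carrier A\<rbrakk> \<Longrightarrow>
        x \<otimes>\<^bsub>A\<^esub> (y \<oplus>\<^bsub>A\<^esub> z) = x \<otimes>\<^bsub>A\<^esub> y \<oplus>\<^bsub>A\<^esub> x \<otimes>\<^bsub>A\<^esub> z"
    and mult_smult_left:
      "\<lbrakk>c \<in> carrier F; x \<in> carrier A; y \<in> carrier A\<rbrakk> \<Longrightarrow>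
        (c \<odot>\<^bsub>A\<^esub> x) \<otimes>\<^bsub>A\<^esub> y = c \<odot>\<^bsub>A\<^esub> (x \<otimes>\<^bsub>A\<^esub> y)"
    and mult_smult_right:
      "\<lbrakk>c \<in> carrier F; x \<in> carrier A; y \<in> carrier A\<rbrakk> \<Longrightarrow>
        x \<otimes>\<^bsub>A\<^esub> (c \<odot>\<^bsub>A\<^esub> y) = c \<odot>\<^bsub>A\<^esub> (x \<otimes>\<^bsub>A\<^esub> y)"

locale left_leibniz_algebra = nonassoc_algebra +
  assumes left_leibniz:
      "\<lbrakk>x \<in> carrier A; y \<in> carrier A; z \<in> carrier A\<rbrakk> \<Longrightarrow>
        x \<otimes>\<^bsub>A\<^esub> (y \<otimes>\<^bsub>A\<^esub> z) = (x \<otimes>\<^bsub>A\<^esub> y) \<otimes>\<^bsub>A\<^esub> z \<oplus>\<^bsub>A\<^esub> y \<otimes>\<^bsub>A\<^esub> (x \<otimes>\<^bsub>A\<^esub> z)"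

definition lin_span ::
  "('f, 'm) ring_scheme \<Rightarrow> ('f, 'a, 'n) module_scheme \<Rightarrow> 'a set \<Rightarrow> 'a set"
  where "lin_span F A S = (\<lambda>U. submodule U F A) hull S"

definition subspace_mult ::
  "('f, 'm) ring_scheme \<Rightarrow> ('f, 'a, 'n) module_scheme \<Rightarrow> 'a set \<Rightarrow> 'a set \<Rightarrow> 'a set"
  where "subspace_mult F A U V = lin_span F A {u \<otimes>\<^bsub>A\<^esub> v | u v. u \<in> U \<and> v \<in> V}"

primrec derived_series ::
  "('f, 'm) ring_scheme \<Rightarrow> ('f, 'a, 'n) module_scheme \<Rightarrow> nat \<Rightarrow> 'a set"
  where
    "derived_series F A 0 = carrier A"
  | "derived_series F A (Suc n) = subspace_mult F A (derived_series F A n) (derived_series F A n)"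

definition solvable_algebra :: "('f, 'm) ring_scheme \<Rightarrow> ('f, 'a, 'n) module_scheme \<Rightarrow> bool"
  where "solvable_algebra F A \<longleftrightarrow> (\<exists>r. derived_series F A r = {\<zero>\<^bsub>A\<^esub>})"

text \<open>
  \<open>FactRing\<close> extended by the induced scalar multiplication. Only meaningful when \<open>I\<close> is a
  two-sided ideal.
\<close>

definition quot_algebra :: "('f, 'a, 'n) module_scheme \<Rightarrow> 'a set \<Rightarrow> ('f, 'a set) module"
  where "quot_algebra A I =
    \<lparr>carrier = a_rcosets\<^bsub>A\<^esub> I, mult = rcoset_mult A I, one = I +>\<^bsub>A\<^esub> \<one>\<^bsub>A\<^esub>,
     zero = I, add = set_add A, smult = (\<lambda>c X. \<Union>x\<in>X. I +>\<^bsub>A\<^esub> (c \<odot>\<^bsub>A\<^esub> x))\<rparr>"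

definition leibniz_kernel ::
  "('f, 'm) ring_scheme \<Rightarrow> ('f, 'a, 'n) module_scheme \<Rightarrow> 'a set"
  where "leibniz_kernel F A = lin_span F A {x \<otimes>\<^bsub>A\<^esub> x | x. x \<in> carrier A}"

definition canonical_lie ::
  "('f, 'm) ring_scheme \<Rightarrow> ('f, 'a, 'n) module_scheme \<Rightarrow> ('f, 'a set) module"
  where "canonical_lie F A = quot_algebra A (leibniz_kernel F A)"

definition left_center :: "('f, 'a, 'n) module_scheme \<Rightarrow> 'a set"
  where "left_center A = {c \<in> carrier A. \<forall>x\<in>carrier A. c \<otimes>\<^bsub>A\<^esub> x = \<zero>\<^bsub>A\<^esub>}"

text \<open>
  Operators on \<open>A\<close> are represented by functions that are \<open>undefined\<close> outside \<open>carrier A\<close>, so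
  that operators agreeing on \<open>carrier A\<close> are equal.
\<close>

definition lin_operators ::
  "('f, 'm) ring_scheme \<Rightarrow> ('f, 'a, 'n) module_scheme \<Rightarrow> ('a \<Rightarrow> 'a) set"
  where "lin_operators F A = {f \<in> carrier A \<rightarrow>\<^sub>E carrier A.
    (\<forall>x\<in>carrier A. \<forall>y\<in>carrier A. f (x \<oplus>\<^bsub>A\<^esub> y) = f x \<oplus>\<^bsub>A\<^esub> f y) \<and>
    (\<forall>c\<in>carrier F. \<forall>x\<in>carrier A. f (c \<odot>\<^bsub>A\<^esub> x) = c \<odot>\<^bsub>A\<^esub> f x)}"

definition gl_algebra ::
  "('f, 'm) ring_scheme \<Rightarrow> ('f, 'a, 'n) module_scheme \<Rightarrow> ('f, 'a \<Rightarrow> 'a) module"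
  where "gl_algebra F A =
    \<lparr>carrier = lin_operators F A,
     mult = (\<lambda>f g. \<lambda>x\<in>carrier A. f (g x) \<ominus>\<^bsub>A\<^esub> g (f x)),
     one = undefined,
     zero = (\<lambda>x\<in>carrier A. \<zero>\<^bsub>A\<^esub>),
     add = (\<lambda>f g. \<lambda>x\<in>carrier A. f x \<oplus>\<^bsub>A\<^esub> g x),
     smult = (\<lambda>c f. \<lambda>x\<in>carrier A. c \<odot>\<^bsub>A\<^esub> f x)\<rparr>"

definition left_mult :: "('f, 'a, 'n) module_scheme \<Rightarrow> 'a \<Rightarrow> 'a \<Rightarrow> 'a"
  where "left_mult A a = (\<lambda>x\<in>carrier A. a \<otimes>\<^bsub>A\<^esub> x)"

definition left_mult_algebra ::
  "('f, 'm) ring_scheme \<Rightarrow> ('f, 'a, 'n) module_scheme \<Rightarrow> ('f, 'a \<Rightarrow> 'a) module"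
  where "left_mult_algebra F A = (gl_algebra F A)\<lparr>carrier := left_mult A ` carrier A\<rparr>"

end

theory Submission
  imports Defs
begin

text \<open>
  A surjective homomorphism maps the derived series of the source onto that of the target.
  Hence, if its kernel \<open>K\<close> lies in the left center, solvability of the target means that some
  member of the derived series of \<open>L\<close> lies in \<open>K\<close>, and then the next member vanishes
  because left central elements annihilate everything from the left. All three algebras are such
  images of \<open>L\<close>: the left Leibniz identity with \<open>x = y\<close> gives \<open>(xx)z = 0\<close>, so the Leibniz
  kernel is contained in the left center, which is also the kernel of \<open>a \<mapsto> L\<^sub>a\<close>.
\<close>

section \<open>Submodules and linear spans\<close>

context module
begin

lemma zero_mem_submodule: "submodule U R M \<Longrightarrow> \<zero>\<^bsub>M\<^esub> \<in> U"
  using submodule.axioms(1) subgroup.one_closed by fastforce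

text \<open>A hull is the intersection of all submodules containing \<open>S\<close>, and every
  closure property passes to intersections. Since \<open>S\<close> lies in the carrier, the carrier
  belongs to this family; for an empty family the hull would be \<open>UNIV\<close>.\<close>

lemma submodule_lin_span:
  assumes "S \<subseteq> carrier M"
  shows "submodule (lin_span R M S) R M"
proof (rule submoduleI)
  show "lin_span R M S \<subseteq> carrier M"
    unfolding lin_span_def using assms carrier_is_submodule by (rule hull_minimal)
  show "\<zero>\<^bsub>M\<^esub> \<in> lin_span R M S"
    by (auto simp: lin_span_def hull_def zero_mem_submodule)
qed (auto simp: lin_span_def hull_def dest: submoduleE)

lemma lin_span_minimal: "S \<subseteq> U \<Longrightarrow> submodule U R M \<Longrightarrow> lin_span R M S \<subseteq> U"
  unfolding lin_span_def by (rule hull_minimal)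

lemma lin_span_superset: "S \<subseteq> lin_span R M S"
  unfolding lin_span_def by (rule hull_subset)

lemma submodule_zero: "submodule {\<zero>\<^bsub>M\<^esub>} R M"
proof (rule submoduleI)
  fix a x assume "a \<in> carrier R" "x \<in> {\<zero>\<^bsub>M\<^esub>}"
  then show "a \<odot>\<^bsub>M\<^esub> x \<in> {\<zero>\<^bsub>M\<^esub>}" by (simp add: smult_r_null)
qed auto

text \<open>Additive inverses are multiples by the scalar \<open>\<ominus> \<one>\<close>, so
  closure under negation follows from closure under scalars.\<close>

lemma submodule_of_smult_closed:
  assumes "U \<subseteq> carrier M" "\<zero>\<^bsub>M\<^esub> \<in> U"
    and "\<And>x y. x \<in> U \<Longrightarrow> y \<in> U \<Longrightarrow> x \<oplus>\<^bsub>M\<^esub> y \<in> U"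
    and smult: "\<And>c x. c \<in> carrier R \<Longrightarrow> x \<in> U \<Longrightarrow> c \<odot>\<^bsub>M\<^esub> x \<in> U"
  shows "submodule U R M"
proof (rule submoduleI)
  fix a assume a: "a \<in> U"
  then have "\<ominus>\<^bsub>M\<^esub> a = (\<ominus> \<one>) \<odot>\<^bsub>M\<^esub> a"
    using assms(1) smult_l_minus[of \<one> a] by auto
  then show "\<ominus>\<^bsub>M\<^esub> a \<in> U" using smult[of "\<ominus> \<one>" a] a by simp
qed (use assms in auto)

end

section \<open>Nonassociative algebras, their surjective homomorphisms and quotients\<close>

context nonassoc_algebra
begin

lemma mult_zero_right:
  assumes "x \<in> carrier A"
  shows "x \<otimes>\<^bsub>A\<^esub> \<zero>\<^bsub>A\<^esub> = \<zero>\<^bsub>A\<^esub>"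
  \<comment> \<open>Zero is written as the scalar zero times itself, and bilinearity pulls the
    scalar out.\<close>
  using mult_smult_right[of "\<zero>\<^bsub>F\<^esub>" x "\<zero>\<^bsub>A\<^esub>"] assms by (simp add: A.smult_l_null)

lemma mult_zero_left:
  assumes "x \<in> carrier A"
  shows "\<zero>\<^bsub>A\<^esub> \<otimes>\<^bsub>A\<^esub> x = \<zero>\<^bsub>A\<^esub>"
  using mult_smult_left[of "\<zero>\<^bsub>F\<^esub>" "\<zero>\<^bsub>A\<^esub>" x] assms by (simp add: A.smult_l_null)

lemma submodule_subspace_mult:
  assumes "U \<subseteq> carrier A" "V \<subseteq> carrier A"
  shows "submodule (subspace_mult F A U V) F A"
  unfolding subspace_mult_def using assms by (intro A.submodule_lin_span) auto

lemma submodule_derived_series: "submodule (derived_series F A n) F A"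
  by (induction n)
    (auto intro!: A.carrier_is_submodule submodule_subspace_mult dest: A.submoduleE(1))

lemma submodule_left_center: "submodule (left_center A) F A"
  by (rule A.submodule_of_smult_closed)
    (auto simp: left_center_def mult_zero_left mult_l_distr mult_smult_left A.smult_r_null)

end

text \<open>\<open>B\<close> is an arbitrary record: no algebra axioms are assumed for it, as
  surjectivity of \<open>h\<close> transports the structure that is used. To apply the locale to a
  quotient or an operator algebra it thus suffices to check the homomorphism equations.
  \<open>map_zero\<close> ties the zero field of \<open>B\<close> to the other operations.\<close>

locale nonassoc_algebra_epi = nonassoc_algebra F A
  for F (structure) and A (structure) +
  fixes B :: "('f, 'b, 'p) module_scheme" (structure) and h
  assumes image_carrier: "h ` carrier A = carrier B"
    and map_zero: "h \<zero>\<^bsub>A\<^esub> = \<zero>\<^bsub>B\<^esub>"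
    and map_add: "\<lbrakk>x \<in> carrier A; y \<in> carrier A\<rbrakk> \<Longrightarrow> h (x \<oplus>\<^bsub>A\<^esub> y) = h x \<oplus>\<^bsub>B\<^esub> h y"
    and map_mult: "\<lbrakk>x \<in> carrier A; y \<in> carrier A\<rbrakk> \<Longrightarrow> h (x \<otimes>\<^bsub>A\<^esub> y) = h x \<otimes>\<^bsub>B\<^esub> h y"
    and map_smult: "\<lbrakk>c \<in> carrier F; x \<in> carrier A\<rbrakk> \<Longrightarrow> h (c \<odot>\<^bsub>A\<^esub> x) = c \<odot>\<^bsub>B\<^esub> h x"
begin

lemma add_group_hom: "group_hom (add_monoid A) (add_monoid B) h"
proof -
  have hom: "h \<in> hom (add_monoid A) (add_monoid B)"
    using image_carrier map_add by (auto simp: hom_def)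
  have "group (add_monoid B)"
    using group.hom_imp_img_group[OF A.M.a_group hom] by (simp add: image_carrier map_zero)
  with hom show ?thesis
    by (simp add: group_hom_def group_hom_axioms_def A.M.a_group)
qed

lemma submodule_image:
  assumes "submodule U F A"
  shows "submodule (h ` U) F B"
\<comment> \<open>The predicate \<open>submodule\<close> only asks for an additive subgroup closed
  under scalars, so it can be verified although \<open>B\<close> is not assumed to be a
  module.\<close>
proof (intro submodule.intro submodule_axioms.intro)
  show "subgroup (h ` U) (add_monoid B)"
    by (rule group_hom.subgroup_img_is_subgroup[OF add_group_hom submodule.axioms(1)[OF assms]])
  fix c y assume c: "c \<in> carrier F" and "y \<in> h ` U"
  then obtain x where "x \<in> U" "y = h x" by auto
  then show "c \<odot>\<^bsub>B\<^esub> y \<in> h ` U"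
    using c A.submoduleE(1,4)[OF assms] map_smult[of c x] by (metis image_eqI subsetD)
qed

lemma submodule_preimage:
  assumes "submodule V F B"
  shows "submodule {x \<in> carrier A. h x \<in> V} F A"
proof -
  interpret V: submodule V F B by fact
  show ?thesis
    using V.one_closed V.m_closed V.smult_closed
    by (intro A.submodule_of_smult_closed) (auto simp: map_zero map_add map_smult)
qed

text \<open>The image of the span is a submodule containing \<open>h\<close> S\<open>, which gives
  one inclusion. For the other, the preimage of any submodule containing\<close>h \<open>S\<close>
  is a submodule containing \<open>S\<close>, hence contains the span of \<open>S\<close>.\<close>

lemma image_lin_span:
  assumes "S \<subseteq> carrier A"
  shows "h ` lin_span F A S = lin_span F B (h ` S)"
proof
  show "lin_span F B (h ` S) \<subseteq> h ` lin_span F A S"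
    unfolding lin_span_def[of F B]
    using A.lin_span_superset
    by (intro hull_minimal submodule_image A.submodule_lin_span assms image_mono) auto
next
  have "lin_span F A S \<subseteq> {x \<in> carrier A. h x \<in> V}" if "h ` S \<subseteq> V" "submodule V F B" for V
    using that assms by (intro A.lin_span_minimal submodule_preimage) auto
  then show "h ` lin_span F A S \<subseteq> lin_span F B (h ` S)"
    unfolding lin_span_def[of F B] hull_def by blast
qed

lemma image_subspace_mult:
  assumes "U \<subseteq> carrier A" "V \<subseteq> carrier A"
  shows "h ` subspace_mult F A U V = subspace_mult F B (h ` U) (h ` V)"
proof -
  let ?S = "{u \<otimes>\<^bsub>A\<^esub> v | u v. u \<in> U \<and> v \<in> V}"
  have "h ` ?S = {u \<otimes>\<^bsub>B\<^esub> v | u v. u \<in> h ` U \<and> v \<in> h ` V}" (is "_ = ?T")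
  proof
    show "h ` ?S \<subseteq> ?T" using assms by (auto simp: subset_iff) (metis imageI map_mult)
    show "?T \<subseteq> h ` ?S" using assms by (auto simp: subset_iff image_iff) (metis map_mult)
  qed
  moreover have "?S \<subseteq> carrier A" using assms by auto
  ultimately show ?thesis by (simp add: subspace_mult_def image_lin_span)
qed

lemma image_derived_series: "h ` derived_series F A n = derived_series F B n"
proof (induction n)
  case 0
  then show ?case by (simp add: image_carrier)
next
  case (Suc n)
  have "derived_series F A n \<subseteq> carrier A"
    using submodule_derived_series A.submoduleE(1) by blast
  then show ?case by (simp add: image_subspace_mult Suc)
qed

lemma solvable_iff:
  assumes ker: "\<And>x. x \<in> carrier A \<Longrightarrow> h x = \<zero>\<^bsub>B\<^esub> \<Longrightarrow> x \<in> left_center A"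
  shows "solvable_algebra F A \<longleftrightarrow> solvable_algebra F B"
proof
  assume "solvable_algebra F A"
  then obtain r where "derived_series F A r = {\<zero>\<^bsub>A\<^esub>}" by (auto simp: solvable_algebra_def)
  then show "solvable_algebra F B"
    using image_derived_series[of r] by (auto simp: solvable_algebra_def map_zero)
next
  assume "solvable_algebra F B"
  then obtain r where r: "derived_series F B r = {\<zero>\<^bsub>B\<^esub>}" by (auto simp: solvable_algebra_def)
  let ?D = "derived_series F A r"
  have D: "?D \<subseteq> carrier A" using submodule_derived_series A.submoduleE(1) by blast
  then have "?D \<subseteq> left_center A" using r image_derived_series[of r] ker by blast
  \<comment> \<open>The left factors are left central, so all generators of the next term vanish:
    the index \<open>r\<close> for \<open>B\<close> becomes \<open>Suc r\<close> for
    \<open>A\<close>.\<close>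
  then have "{u \<otimes>\<^bsub>A\<^esub> v | u v. u \<in> ?D \<and> v \<in> ?D} \<subseteq> {\<zero>\<^bsub>A\<^esub>}"
    using D by (auto simp: left_center_def)
  then have "derived_series F A (Suc r) \<subseteq> {\<zero>\<^bsub>A\<^esub>}"
    by (simp only: derived_series.simps subspace_mult_def A.lin_span_minimal A.submodule_zero)
  moreover have "\<zero>\<^bsub>A\<^esub> \<in> derived_series F A (Suc r)"
    by (rule A.zero_mem_submodule[OF submodule_derived_series])
  ultimately show "solvable_algebra F A" unfolding solvable_algebra_def by blast
qed

end

text \<open>Products and scalar multiples of cosets are unions over all representatives. They are
  the expected single cosets because the coset in the union does not depend on the representatives,
  which for products is where both ideal properties enter.\<close>

lemma (in nonassoc_algebra) quot_algebra_epi: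
  assumes I: "submodule I F A"
    and left: "\<And>a i. a \<in> carrier A \<Longrightarrow> i \<in> I \<Longrightarrow> a \<otimes>\<^bsub>A\<^esub> i \<in> I"
    and right: "\<And>a i. a \<in> carrier A \<Longrightarrow> i \<in> I \<Longrightarrow> i \<otimes>\<^bsub>A\<^esub> a \<in> I"
  shows "nonassoc_algebra_epi F A (quot_algebra A I) (\<lambda>x. I +>\<^bsub>A\<^esub> x)"
proof -
  have sub: "subgroup I (add_monoid A)" using I by (rule submodule.axioms(1))
  interpret I: abelian_subgroup I A
    using abelian_subgroupI3[OF additive_subgroup.intro[OF sub] A.M.abelian_group_axioms] .
  have IA: "I \<subseteq> carrier A" using A.submoduleE(1)[OF I] .
  have coset_self: "x \<in> I +>\<^bsub>A\<^esub> x" if "x \<in> carrier A" for x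
    using I.a_rcos_self that .
  have cosetE: "\<exists>i\<in>I. x' = i \<oplus>\<^bsub>A\<^esub> x" if "x' \<in> I +>\<^bsub>A\<^esub> x" for x x'
    using that by (auto simp: a_r_coset_def')
  have coset_eq: "I +>\<^bsub>A\<^esub> (i \<oplus>\<^bsub>A\<^esub> x) = I +>\<^bsub>A\<^esub> x" if "i \<in> I" "x \<in> carrier A" for i x
    using A.M.a_repr_independence[OF A.M.a_rcosI[OF that(1) IA that(2)] that(2) sub] by simp
  have mult_eq: "I +>\<^bsub>A\<^esub> (x' \<otimes>\<^bsub>A\<^esub> y') = I +>\<^bsub>A\<^esub> (x \<otimes>\<^bsub>A\<^esub> y)"
    if xy: "x \<in> carrier A" "y \<in> carrier A" "x' \<in> I +>\<^bsub>A\<^esub> x" "y' \<in> I +>\<^bsub>A\<^esub> y" for x y x' y'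
  proof -
    obtain i j where ij: "i \<in> I" "x' = i \<oplus>\<^bsub>A\<^esub> x" "j \<in> I" "y' = j \<oplus>\<^bsub>A\<^esub> y"
      using cosetE xy(3,4) by blast
    have c: "i \<in> carrier A" "j \<in> carrier A" using ij IA by auto
    \<comment> \<open>The product is grouped as an error term plus \<open>xy\<close>. In the error,
      \<open>i(j + y)\<close> lies in \<open>I\<close> by \<open>right\<close> and \<open>xj\<close>
      by \<open>left\<close>.\<close>
    have "x' \<otimes>\<^bsub>A\<^esub> y' = (i \<otimes>\<^bsub>A\<^esub> (j \<oplus>\<^bsub>A\<^esub> y) \<oplus>\<^bsub>A\<^esub> x \<otimes>\<^bsub>A\<^esub> j) \<oplus>\<^bsub>A\<^esub> x \<otimes>\<^bsub>A\<^esub> y"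
      using c xy(1,2) by (simp add: ij mult_l_distr mult_r_distr A.M.a_ac)
    moreover have "i \<otimes>\<^bsub>A\<^esub> (j \<oplus>\<^bsub>A\<^esub> y) \<oplus>\<^bsub>A\<^esub> x \<otimes>\<^bsub>A\<^esub> j \<in> I"
      using c xy(1,2) ij left right A.submoduleE(5)[OF I] by simp
    ultimately show ?thesis using coset_eq xy(1,2) by simp
  qed
  have smult_eq: "I +>\<^bsub>A\<^esub> (c \<odot>\<^bsub>A\<^esub> x') = I +>\<^bsub>A\<^esub> (c \<odot>\<^bsub>A\<^esub> x)"
    if x: "c \<in> carrier F" "x \<in> carrier A" "x' \<in> I +>\<^bsub>A\<^esub> x" for c x x'
  proof -
    obtain i where i: "i \<in> I" "x' = i \<oplus>\<^bsub>A\<^esub> x" using cosetE x(3) by blast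
    then have "c \<odot>\<^bsub>A\<^esub> x' = c \<odot>\<^bsub>A\<^esub> i \<oplus>\<^bsub>A\<^esub> c \<odot>\<^bsub>A\<^esub> x"
      using x IA by (auto intro!: A.smult_r_distr)
    then show ?thesis using coset_eq A.submoduleE(4)[OF I] x i by simp
  qed
  show ?thesis
  proof (intro nonassoc_algebra_epi.intro nonassoc_algebra_epi_axioms.intro nonassoc_algebra_axioms)
    show "(\<lambda>x. I +>\<^bsub>A\<^esub> x) ` carrier A = carrier (quot_algebra A I)"
      by (auto simp: quot_algebra_def A_RCOSETS_def')
    show "I +>\<^bsub>A\<^esub> \<zero>\<^bsub>A\<^esub> = \<zero>\<^bsub>quot_algebra A I\<^esub>"
      using IA by (simp add: quot_algebra_def)
  next
    fix x y assume xy: "x \<in> carrier A" "y \<in> carrier A"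
    show "I +>\<^bsub>A\<^esub> (x \<oplus>\<^bsub>A\<^esub> y) = (I +>\<^bsub>A\<^esub> x) \<oplus>\<^bsub>quot_algebra A I\<^esub> (I +>\<^bsub>A\<^esub> y)"
      using xy by (simp add: quot_algebra_def I.a_rcos_sum)
    show "I +>\<^bsub>A\<^esub> (x \<otimes>\<^bsub>A\<^esub> y) = (I +>\<^bsub>A\<^esub> x) \<otimes>\<^bsub>quot_algebra A I\<^esub> (I +>\<^bsub>A\<^esub> y)"
    proof -
      have "rcoset_mult A I (I +>\<^bsub>A\<^esub> x) (I +>\<^bsub>A\<^esub> y) =
          (\<Union>x'\<in>I +>\<^bsub>A\<^esub> x. \<Union>y'\<in>I +>\<^bsub>A\<^esub> y. I +>\<^bsub>A\<^esub> (x \<otimes>\<^bsub>A\<^esub> y))"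
        unfolding rcoset_mult_def by (intro SUP_cong refl mult_eq[OF xy])
      \<comment> \<open>The union of a constant family collapses only over nonempty index sets; each
        coset contains its representative.\<close>
      also have "\<dots> = I +>\<^bsub>A\<^esub> (x \<otimes>\<^bsub>A\<^esub> y)"
        using coset_self[OF xy(1)] coset_self[OF xy(2)] by auto
      finally show ?thesis by (simp add: quot_algebra_def)
    qed
  next
    fix c x assume cx: "c \<in> carrier F" "x \<in> carrier A"
    show "I +>\<^bsub>A\<^esub> (c \<odot>\<^bsub>A\<^esub> x) = c \<odot>\<^bsub>quot_algebra A I\<^esub> (I +>\<^bsub>A\<^esub> x)"
    proof -
      have "(\<Union>x'\<in>I +>\<^bsub>A\<^esub> x. I +>\<^bsub>A\<^esub> (c \<odot>\<^bsub>A\<^esub> x')) = (\<Union>x'\<in>I +>\<^bsub>A\<^esub> x. I +>\<^bsub>A\<^esub> (c \<odot>\<^bsub>A\<^esub> x))"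
        by (intro SUP_cong refl smult_eq[OF cx])
      also have "\<dots> = I +>\<^bsub>A\<^esub> (c \<odot>\<^bsub>A\<^esub> x)" using coset_self[OF cx(2)] by auto
      finally show ?thesis by (simp add: quot_algebra_def)
    qed
  qed
qed

section \<open>Left Leibniz algebras: left center, Leibniz kernel, left multiplications\<close>

context left_leibniz_algebra
begin

text \<open>Left central elements satisfy \<open>ia = 0\<close>, so \<open>I\<close> is
  automatically a right ideal and only the left ideal property has to be supplied. The kernel of the
  projection is \<open>I\<close>, which lies in the left center.\<close>

lemma solvable_iff_solvable_quot:
  assumes I: "submodule I F A" "I \<subseteq> left_center A"
    and left: "\<And>a i. a \<in> carrier A \<Longrightarrow> i \<in> I \<Longrightarrow> a \<otimes>\<^bsub>A\<^esub> i \<in> I"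
  shows "solvable_algebra F A \<longleftrightarrow> solvable_algebra F (quot_algebra A I)"
proof (rule nonassoc_algebra_epi.solvable_iff[OF quot_algebra_epi[OF I(1)]])
  show "i \<otimes>\<^bsub>A\<^esub> a \<in> I" if "a \<in> carrier A" "i \<in> I" for a i
    using that I A.zero_mem_submodule[OF I(1)] by (auto simp: left_center_def)
  show "x \<in> left_center A" if "x \<in> carrier A" "I +>\<^bsub>A\<^esub> x = \<zero>\<^bsub>quot_algebra A I\<^esub>" for x
    using A.M.a_coset_join1[OF _ that(1) submodule.axioms(1)[OF I(1)]] that(2) I(2)
    by (auto simp: quot_algebra_def)
qed (rule left)

lemma square_mem_left_center:
  assumes "x \<in> carrier A"
  shows "x \<otimes>\<^bsub>A\<^esub> x \<in> left_center A"
proof -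
  have "(x \<otimes>\<^bsub>A\<^esub> x) \<otimes>\<^bsub>A\<^esub> z = \<zero>\<^bsub>A\<^esub>" if z: "z \<in> carrier A" for z
    \<comment> \<open>The identity reads \<open>x(xz) = (xx)z + x(xz)\<close>, and
      \<open>x(xz)\<close> cancels.\<close>
    by (rule iffD1[OF A.M.add.r_cancel_one'])
      (use left_leibniz[OF assms assms z] assms z in auto)
  then show ?thesis using assms by (simp add: left_center_def)
qed

text \<open>In \<open>a(cx) = (ac)x + c(ax)\<close> both \<open>cx\<close> and \<open>c(ax)\<close>
  vanish, which leaves \<open>(ac)x = 0\<close>.\<close>

lemma left_center_left_ideal:
  assumes "a \<in> carrier A" "c \<in> left_center A"
  shows "a \<otimes>\<^bsub>A\<^esub> c \<in> left_center A"
proof -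
  have c: "c \<in> carrier A" "\<And>x. x \<in> carrier A \<Longrightarrow> c \<otimes>\<^bsub>A\<^esub> x = \<zero>\<^bsub>A\<^esub>"
    using assms(2) by (auto simp: left_center_def)
  have "(a \<otimes>\<^bsub>A\<^esub> c) \<otimes>\<^bsub>A\<^esub> x = \<zero>\<^bsub>A\<^esub>" if "x \<in> carrier A" for x
    using left_leibniz[of a c x] that assms(1) c by (simp add: mult_zero_right)
  then show ?thesis using assms(1) c by (simp add: left_center_def)
qed

lemma submodule_leibniz_kernel: "submodule (leibniz_kernel F A) F A"
  unfolding leibniz_kernel_def by (rule A.submodule_lin_span) auto

lemma leibniz_kernel_subset_left_center: "leibniz_kernel F A \<subseteq> left_center A"
  unfolding leibniz_kernel_def
  by (rule A.lin_span_minimal) (auto intro: square_mem_left_center submodule_left_center)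

lemma square_mem_leibniz_kernel: "x \<in> carrier A \<Longrightarrow> x \<otimes>\<^bsub>A\<^esub> x \<in> leibniz_kernel F A"
  unfolding leibniz_kernel_def by (rule subsetD[OF A.lin_span_superset]) auto

text \<open>Elements \<open>i\<close> of the kernel are left central, so \<open>(a + i)(a + i) = aa + ai\<close>.\<close>

lemma leibniz_kernel_left_ideal:
  assumes a: "a \<in> carrier A" and i: "i \<in> leibniz_kernel F A"
  shows "a \<otimes>\<^bsub>A\<^esub> i \<in> leibniz_kernel F A"
proof -
  note K = A.submoduleE[OF submodule_leibniz_kernel]
  have ic: "i \<in> carrier A" "\<And>x. x \<in> carrier A \<Longrightarrow> i \<otimes>\<^bsub>A\<^esub> x = \<zero>\<^bsub>A\<^esub>"
    using i leibniz_kernel_subset_left_center by (auto simp: left_center_def)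
  have "(a \<oplus>\<^bsub>A\<^esub> i) \<otimes>\<^bsub>A\<^esub> (a \<oplus>\<^bsub>A\<^esub> i) = a \<otimes>\<^bsub>A\<^esub> a \<oplus>\<^bsub>A\<^esub> a \<otimes>\<^bsub>A\<^esub> i"
    using a ic by (simp add: mult_l_distr mult_r_distr)
  then have "a \<otimes>\<^bsub>A\<^esub> i = \<ominus>\<^bsub>A\<^esub> (a \<otimes>\<^bsub>A\<^esub> a) \<oplus>\<^bsub>A\<^esub> (a \<oplus>\<^bsub>A\<^esub> i) \<otimes>\<^bsub>A\<^esub> (a \<oplus>\<^bsub>A\<^esub> i)"
    using a ic by (simp add: A.M.r_neg1)
  then show ?thesis using K(3,5) square_mem_leibniz_kernel a ic(1) by simp
qed

text \<open>The left Leibniz identity, solved for \<open>(xy)z\<close>, says that left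
  multiplication by \<open>xy\<close> is the commutator of those by \<open>x\<close> and
  \<open>y\<close>. Surjectivity is built into the carrier of the target.\<close>

lemma left_mult_algebra_epi:
  "nonassoc_algebra_epi F A (left_mult_algebra F A) (left_mult A)"
proof (intro nonassoc_algebra_epi.intro nonassoc_algebra_epi_axioms.intro nonassoc_algebra_axioms)
  fix x y assume xy: "x \<in> carrier A" "y \<in> carrier A"
  have "(x \<otimes>\<^bsub>A\<^esub> y) \<otimes>\<^bsub>A\<^esub> z = x \<otimes>\<^bsub>A\<^esub> (y \<otimes>\<^bsub>A\<^esub> z) \<ominus>\<^bsub>A\<^esub> y \<otimes>\<^bsub>A\<^esub> (x \<otimes>\<^bsub>A\<^esub> z)"
    if z: "z \<in> carrier A" for z
    unfolding left_leibniz[OF xy z] using xy z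
    by (simp add: A.M.minus_eq A.M.a_assoc A.M.r_neg)
  then show "left_mult A (x \<otimes>\<^bsub>A\<^esub> y) = left_mult A x \<otimes>\<^bsub>left_mult_algebra F A\<^esub> left_mult A y"
    using xy by (auto simp: left_mult_algebra_def gl_algebra_def left_mult_def)
  show "left_mult A (x \<oplus>\<^bsub>A\<^esub> y) = left_mult A x \<oplus>\<^bsub>left_mult_algebra F A\<^esub> left_mult A y"
    using xy by (auto simp: left_mult_algebra_def gl_algebra_def left_mult_def mult_l_distr)
qed (auto simp: left_mult_algebra_def gl_algebra_def left_mult_def mult_smult_left mult_zero_left)

lemma left_mult_eq_zero:
  assumes "x \<in> carrier A" "left_mult A x = \<zero>\<^bsub>left_mult_algebra F A\<^esub>"
  shows "x \<in> left_center A"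
proof -
  have "x \<otimes>\<^bsub>A\<^esub> y = \<zero>\<^bsub>A\<^esub>" if "y \<in> carrier A" for y
    using fun_cong[OF assms(2), of y] that
    by (simp add: left_mult_algebra_def gl_algebra_def left_mult_def)
  then show ?thesis using assms(1) by (simp add: left_center_def)
qed

end

theorem proposition6p1:
  fixes F :: "('f, 'm) ring_scheme" and L :: "('f, 'a, 'n) module_scheme"
  assumes "left_leibniz_algebra F L"
  shows "(solvable_algebra F L \<longleftrightarrow> solvable_algebra F (canonical_lie F L)) \<and>
    (solvable_algebra F L \<longleftrightarrow> solvable_algebra F (quot_algebra L (left_center L))) \<and>
    (solvable_algebra F L \<longleftrightarrow> solvable_algebra F (left_mult_algebra F L))"
proof -
  interpret left_leibniz_algebra F L by fact
  show ?thesis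
    \<comment> \<open>Two of the equivalences are instances of the same quotient criterion, for the
      Leibniz kernel and for the left center.\<close>
    unfolding canonical_lie_def
    using solvable_iff_solvable_quot[OF submodule_leibniz_kernel
        leibniz_kernel_subset_left_center leibniz_kernel_left_ideal]
      solvable_iff_solvable_quot[OF submodule_left_center subset_refl left_center_left_ideal]
      nonassoc_algebra_epi.solvable_iff[OF left_mult_algebra_epi left_mult_eq_zero]
    by blast
qed

end
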